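(* Let $n\geq 1$ be an integer. Among the balls $B_p^n$, $p\in[1,\infty]$, the functional $\phi$ is maximized by the Euclidean ball $B_2^n$; that is, $$\max_{p\in[1,\infty]}\phi(B_p^n)=\phi(B_2^n)=\frac{n}{(n+2)^2}.$$
   Context: A convex body in $\mathbb{R}^n$ is a compact convex set with non-empty interior; $\langle\cdot,\cdot\rangle$ is the standard scalar product and $|\cdot|$ denotes $n$-dimensional volume (Lebesgue measure). The polar of a convex body $K\subset\mathbb{R}^n$ is $K^\circ=\{x\in\mathbb{R}^n : \langle x,y\rangle\leq 1 \text{ for all } y\in K\}$. For a centrally symmetric convex body $K\subset\mathbb{R}^n$ define $$\phi(K)=\frac{1}{|K||K^\circ|}\int_K\int_{K^\circ}\langle x,y\rangle^2\,dy\,dx.$$ For $p\in[1,\infty)$, $B_p^n=\{x\in\mathbb{R}^n : \sum_{i=1}^n|x_i|^p\leq 1\}$, and $B_\infty^n=\{x\in\mathbb{R}^n : \max_i|x_i|\leq 1\}$. *)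

theory Defs
  imports "HOL-Analysis.Analysis"
begin

definition polar_body :: "'a::real_inner set \<Rightarrow> 'a set" where
  "polar_body K = {x. \<forall>y\<in>K. x \<bullet> y \<le> 1}"

(* Intended for centrally symmetric convex bodies. There K and its polar are compact with
   positive volume and the integrand is continuous, so the conventions for division by zero
   and for non-integrable functions play no role. *)
definition phi :: "'a::euclidean_space set \<Rightarrow> real" where
  "phi K = 1 / (measure lborel K * measure lborel (polar_body K)) *
     (LINT x:K|lborel. (LINT y:polar_body K|lborel. (x \<bullet> y)\<^sup>2))"

definition lp_ball :: "ereal \<Rightarrow> (real ^ 'n) set" where
  "lp_ball p =
     (if p = \<infinity> then {x. (MAX i. \<bar>x $ i\<bar>) \<le> 1}
      else {x. (\<Sum>i\<in>UNIV. \<bar>x $ i\<bar> powr real_of_ereal p) \<le> 1})"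

end

theory Submission
  imports Defs
begin

text \<open>
  The balls are invariant under reflections in coordinate hyperplanes and \<open>B\<^sub>p\<close>, \<open>B\<^sub>q\<close> are polar
  to each other for conjugate exponents, so \<open>\<phi>(B\<^sub>p) = n A(1/p) A(1/q)\<close>, where \<open>A(1/p)\<close> is the
  mean of \<open>x\<^sub>1\<^sup>2\<close> over \<open>B\<^sub>p\<close>. Integrating against \<open>exp (- \<Sum>\<^sub>i |x\<^sub>i|\<^sup>p)\<close> gives
  \<open>A(s) = n/(n+2) exp (- G(s))\<close> with
  \<open>G(s) = ln \<Gamma>(s) + ln \<Gamma>((n+2)s) - ln \<Gamma>(ns) - ln \<Gamma>(3s)\<close>, and since the two arguments \<open>1/p\<close>, \<open>1/q\<close>
  add up to 1, it suffices that \<open>G\<close> is midpoint convex. Gauss's product for \<open>\<Gamma>\<close> and Frullani's integral give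
  \<open>G(s) = \<integral> w(u) / (1 - exp (-u/s)) du\<close> over \<open>u > 0\<close> with
  \<open>w(u) = exp (-u) (1 - exp (-2u)) (1 - exp (-(n-1)u)) / u \<ge> 0\<close>, and \<open>r \<mapsto> 1 / (1 - exp (-1/r))\<close> is convex.
  The exponents 1 and \<open>\<infinity>\<close> are computed directly.
\<close>

subsection \<open>Convexity of the Gamma quotient\<close>

text \<open>The difference of the two sides vanishes at 0 and has derivative
  \<open>1 - exp (- y) * (1 + y)\<close>, which is nonnegative because 1 + y \<le> exp y. With x =
  1/r it gives the sign of the second derivative in the next lemma.\<close>

lemma two_mult_one_minus_exp_le:
  fixes x :: real
  assumes "0 \<le> x"
  shows "2 * (1 - exp (- x)) \<le> x * (1 + exp (- x))"
proof -
  define h where "h = (\<lambda>x::real. x * (1 + exp (- x)) - 2 * (1 - exp (- x)))"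
  have "h 0 \<le> h x"
  proof (rule DERIV_nonneg_imp_nondecreasing[OF assms])
    fix y :: real
    assume y: "0 \<le> y" "y \<le> x"
    have d: "(h has_real_derivative 1 - exp (- y) * (1 + y)) (at y)"
      unfolding h_def by (auto intro!: derivative_eq_intros simp: algebra_simps)
    have "exp (- y) * (1 + y) \<le> exp (- y) * exp y"
      by (intro mult_left_mono exp_ge_add_one_self) auto
    then have "0 \<le> 1 - exp (- y) * (1 + y)"
      by (simp flip: exp_add)
    with d show "\<exists>z. (h has_real_derivative z) (at y) \<and> 0 \<le> z" by blast
  qed
  then show ?thesis by (simp add: h_def)
qed

text \<open>With e = exp (-1/r), the second derivative is a positive factor times 1 + e - 2r(1 - e).
  The preceding inequality at 1/r, multiplied by r, makes this nonnegative.\<close>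

lemma convex_on_inverse_one_minus_exp:
  "convex_on {0<..} (\<lambda>r::real. 1 / (1 - exp (- 1 / r)))"
proof (rule f''_ge0_imp_convex)
  fix r :: real
  assume "r \<in> {0<..}"
  then have r: "0 < r" by simp
  let ?e = "exp (- 1 / r)"
  have e: "?e < 1" using r by simp
  have de: "((\<lambda>r. exp (- 1 / r)) has_real_derivative ?e / r\<^sup>2) (at r)"
    using r by (auto intro!: derivative_eq_intros simp: power2_eq_square)
  show "((\<lambda>r. 1 / (1 - exp (- 1 / r))) has_real_derivative ?e / (r\<^sup>2 * (1 - ?e)\<^sup>2)) (at r)"
    using r e by (auto intro!: derivative_eq_intros de simp: field_simps power2_eq_square)
  show "((\<lambda>r. exp (- 1 / r) / (r\<^sup>2 * (1 - exp (- 1 / r))\<^sup>2)) has_real_derivative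
      ?e / (r ^ 4 * (1 - ?e) ^ 3) * (1 + ?e - 2 * r * (1 - ?e))) (at r)"
  proof -
    have ne: "1 - ?e \<noteq> 0" "r \<noteq> 0" using e r by auto
    have dd: "((\<lambda>r. r\<^sup>2 * (1 - exp (- 1 / r))\<^sup>2) has_real_derivative
        2 * r * (1 - ?e)\<^sup>2 - 2 * (1 - ?e) * ?e) (at r)"
      using ne by (auto intro!: derivative_eq_intros de simp: field_simps power2_eq_square)
    \<comment> \<open>The quotient rule produces the denominator r^4 d^4. One factor d = 1 - e also
      divides the numerator and cancels.\<close>
    have "?e / (r ^ 4 * d ^ 3) * (1 + ?e - 2 * r * d)
      = (?e / r\<^sup>2 * (r\<^sup>2 * d\<^sup>2) - ?e * (2 * r * d\<^sup>2 - 2 * d * ?e)) / (r\<^sup>2 * d\<^sup>2 * (r\<^sup>2 * d\<^sup>2))"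
      if "d = 1 - ?e" for d
    proof -
      have "?e / r\<^sup>2 * (r\<^sup>2 * d\<^sup>2) - ?e * (2 * r * d\<^sup>2 - 2 * d * ?e) = d * (?e * (d + 2 * ?e - 2 * r * d))"
        using ne by (simp add: power2_eq_square algebra_simps)
      moreover have "r\<^sup>2 * d\<^sup>2 * (r\<^sup>2 * d\<^sup>2) = d * (r ^ 4 * d ^ 3)"
        by (simp add: power2_eq_square power3_eq_cube power4_eq_xxxx)
      moreover have "1 + ?e - 2 * r * d = d + 2 * ?e - 2 * r * d"
        using that by simp
      ultimately show ?thesis
        using that ne by (simp only: mult_divide_mult_cancel_left times_divide_eq_left simp_thms)
    qed
    with DERIV_divide[OF de dd] ne show ?thesis by simp
  qed
  have "2 * (1 - ?e) \<le> 1 / r * (1 + ?e)"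
    using two_mult_one_minus_exp_le[of "1 / r"] r by simp
  then have "2 * r * (1 - ?e) \<le> 1 + ?e"
    using r by (simp add: field_simps)
  then show "0 \<le> ?e / (r ^ 4 * (1 - ?e) ^ 3) * (1 + ?e - 2 * r * (1 - ?e))"
    using r e by simp
qed auto

section \<open>Frullani integrals and the Laplace transform of the weight\<close>

lemma nn_integral_exp_decay:
  fixes c :: real
  assumes "0 < c"
  shows "(\<integral>\<^sup>+t\<in>{0<..}. ennreal (exp (- (c * t))) \<partial>lborel) = ennreal (1 / c)"
proof -
  have "(\<integral>\<^sup>+t\<in>{0<..}. ennreal (exp (- (c * t))) \<partial>lborel)
      = (\<integral>\<^sup>+t. ennreal (exp (- (c * t))) * indicator {0..} t \<partial>lborel)"
  proof (rule nn_integral_cong_AE)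
    show "AE t in lborel. ennreal (exp (- (c * t))) * indicator {0<..} t
        = ennreal (exp (- (c * t))) * indicator {0..} t"
      using AE_lborel_singleton[of "0::real"] by eventually_elim (auto simp: indicator_def)
  qed
  also have "\<dots> = ennreal (0 - (- exp (- (c * 0)) / c))"
  proof (rule nn_integral_FTC_atLeast)
    show "((\<lambda>t. - exp (- (c * t)) / c) \<longlongrightarrow> 0) at_top"
    proof -
      have "((\<lambda>t. exp (- (c * t))) \<longlongrightarrow> 0) at_top"
        using assms by (intro filterlim_compose[OF exp_at_bot])
          (auto simp: filterlim_uminus_at_bot intro!: filterlim_tendsto_pos_mult_at_top[OF tendsto_const] filterlim_ident)
      from tendsto_divide[OF tendsto_minus[OF this] tendsto_const[of c]] assms show ?thesis by simp
    qed
    show "((\<lambda>t. - exp (- (c * t)) / c) has_real_derivative exp (- (c * t))) (at t)" for t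
      using assms by (auto intro!: derivative_eq_intros)
  qed auto
  finally show ?thesis by simp
qed

text \<open>The integrand is the integral of exp (-ct) over c in [a, b]. By Tonelli the t-integral
  can be done first; it gives 1/c, whose integral over [a, b] is the logarithm.\<close>

lemma nn_integral_Frullani_exp:
  fixes a b :: real
  assumes "0 < a" "a \<le> b"
  shows "(\<integral>\<^sup>+t\<in>{0<..}. ennreal ((exp (- (a * t)) - exp (- (b * t))) / t) \<partial>lborel) = ennreal (ln (b / a))"
proof -
  have inner: "(\<integral>\<^sup>+c. ennreal (exp (- (c * t))) * indicator {a..b} c \<partial>lborel)
      = ennreal ((exp (- (a * t)) - exp (- (b * t))) / t)" if "0 < t" for t
  proof -
    have "(\<integral>\<^sup>+c. ennreal (exp (- (c * t))) * indicator {a..b} c \<partial>lborel)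
        = ennreal ((- exp (- (b * t)) / t) - (- exp (- (a * t)) / t))"
      using that assms by (intro nn_integral_FTC_Icc) (auto intro!: derivative_eq_intros)
    then show ?thesis by (simp add: diff_divide_distrib)
  qed
  have "(\<integral>\<^sup>+t\<in>{0<..}. ennreal ((exp (- (a * t)) - exp (- (b * t))) / t) \<partial>lborel)
      = (\<integral>\<^sup>+t. (\<integral>\<^sup>+c. ennreal (exp (- (c * t))) * indicator {a..b} c * indicator {0<..} t \<partial>lborel) \<partial>lborel)"
  proof (intro nn_integral_cong)
    fix t :: real
    show "ennreal ((exp (- (a * t)) - exp (- (b * t))) / t) * indicator {0<..} t
        = (\<integral>\<^sup>+c. ennreal (exp (- (c * t))) * indicator {a..b} c * indicator {0<..} t \<partial>lborel)"
      by (cases "0 < t") (simp_all add: inner)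
  qed
  also have "\<dots> = (\<integral>\<^sup>+c. (\<integral>\<^sup>+t. ennreal (exp (- (c * t))) * indicator {a..b} c * indicator {0<..} t \<partial>lborel) \<partial>lborel)"
    by (rule lborel_pair.Fubini') measurable
  also have "\<dots> = (\<integral>\<^sup>+c. ennreal (1 / c) * indicator {a..b} c \<partial>lborel)"
  proof (intro nn_integral_cong)
    fix c :: real
    show "(\<integral>\<^sup>+t. ennreal (exp (- (c * t))) * indicator {a..b} c * indicator {0<..} t \<partial>lborel)
        = ennreal (1 / c) * indicator {a..b} c"
      using assms nn_integral_exp_decay[of c] by (auto simp: indicator_def)
  qed
  also have "\<dots> = ennreal (ln b - ln a)"
    using assms by (intro nn_integral_FTC_Icc) (auto intro!: derivative_eq_intros simp: inverse_eq_divide)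
  finally show ?thesis using assms by (simp add: ln_div)
qed

text \<open>\<open>u\<close> times the weight is \<open>exp (-u) - exp (-3u) - exp (-nu) + exp (-(n+2)u)\<close>, so that
  its Laplace transform is a difference of two Frullani integrals.\<close>

definition Gamma_weight :: "real \<Rightarrow> real \<Rightarrow> real" where
  "Gamma_weight n u = exp (- u) * (1 - exp (- (2 * u))) * (1 - exp (- ((n - 1) * u))) / u"

lemma Gamma_weight_measurable [measurable]: "Gamma_weight n \<in> borel_measurable borel"
  unfolding Gamma_weight_def by measurable

lemma Gamma_weight_nonneg: "1 \<le> n \<Longrightarrow> 0 < u \<Longrightarrow> 0 \<le> Gamma_weight n u"
  unfolding Gamma_weight_def by (intro divide_nonneg_pos mult_nonneg_nonneg) auto

lemma nn_integral_exp_Gamma_weight: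
  fixes n v :: real
  assumes n: "1 \<le> n" and v: "0 \<le> v"
  shows "(\<integral>\<^sup>+u\<in>{0<..}. ennreal (exp (- (v * u)) * Gamma_weight n u) \<partial>lborel)
    = ennreal (ln ((v + n) * (v + 3) / ((v + 1) * (v + n + 2))))" (is "?I = _")
proof -
  have split: "exp (- (v * u)) * Gamma_weight n u + (exp (- ((v + n) * u)) - exp (- ((v + n + 2) * u))) / u
      = (exp (- ((v + 1) * u)) - exp (- ((v + 3) * u))) / u" for u
  proof -
    have e: "exp (- ((v + n) * u)) = exp (- (v * u)) * exp (- u) * exp (- ((n - 1) * u))"
      "exp (- ((v + n + 2) * u)) = exp (- (v * u)) * exp (- u) * exp (- (2 * u)) * exp (- ((n - 1) * u))"
      "exp (- ((v + 1) * u)) = exp (- (v * u)) * exp (- u)"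
      "exp (- ((v + 3) * u)) = exp (- (v * u)) * exp (- u) * exp (- (2 * u))"
      by (simp_all add: algebra_simps flip: exp_add)
    show ?thesis unfolding e Gamma_weight_def
      by (simp add: algebra_simps diff_divide_distrib add_divide_distrib)
  qed
  \<comment> \<open>Subtraction is delicate in \<open>ennreal\<close>, so the second Frullani
    integral is added to both sides as in \<open>split\<close>, and removed at the end, where its
    finiteness permits cancellation.\<close>
  have "?I + ennreal (ln ((v + n + 2) / (v + n)))
      = (\<integral>\<^sup>+u. ennreal (exp (- (v * u)) * Gamma_weight n u) * indicator {0<..} u
          + ennreal ((exp (- ((v + n) * u)) - exp (- ((v + n + 2) * u))) / u) * indicator {0<..} u \<partial>lborel)"
    using n v by (subst nn_integral_add) (auto simp: nn_integral_Frullani_exp)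
  also have "\<dots> = (\<integral>\<^sup>+u\<in>{0<..}. ennreal ((exp (- ((v + 1) * u)) - exp (- ((v + 3) * u))) / u) \<partial>lborel)"
  proof (intro nn_integral_cong)
    fix u :: real
    show "ennreal (exp (- (v * u)) * Gamma_weight n u) * indicator {0<..} u
          + ennreal ((exp (- ((v + n) * u)) - exp (- ((v + n + 2) * u))) / u) * indicator {0<..} u
        = ennreal ((exp (- ((v + 1) * u)) - exp (- ((v + 3) * u))) / u) * indicator {0<..} u"
    proof (cases "0 < u")
      case True
      have "(v + n) * u \<le> (v + n + 2) * u" using True n v by (intro mult_right_mono) auto
      then have "0 \<le> (exp (- ((v + n) * u)) - exp (- ((v + n + 2) * u))) / u"
        using True by simp
      with True n show ?thesis
        by (simp add: Gamma_weight_nonneg split flip: ennreal_plus)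
    qed simp
  qed
  also have "\<dots> = ennreal (ln ((v + 3) / (v + 1)))"
    using v by (intro nn_integral_Frullani_exp) auto
  finally have "?I + ennreal (ln ((v + n + 2) / (v + n))) = ennreal (ln ((v + 3) / (v + 1)))" .
  then have "?I = ennreal (ln ((v + 3) / (v + 1))) - ennreal (ln ((v + n + 2) / (v + n)))"
    by (metis ennreal_add_diff_cancel_right ennreal_neq_top)
  also have "\<dots> = ennreal (ln ((v + 3) / (v + 1)) - ln ((v + n + 2) / (v + n)))"
    using n v by (intro ennreal_minus) simp
  also have "ln ((v + 3) / (v + 1)) - ln ((v + n + 2) / (v + n))
      = ln ((v + n) * (v + 3) / ((v + 1) * (v + n + 2)))"
    using n v by (simp add: ln_div ln_mult)
  finally show ?thesis .
qed

text \<open>Up to a constant factor, the mean of \<open>x\<^sub>1\<^sup>2\<close> over \<open>B\<^sub>p\<^sup>n\<close> is \<open>exp\<close> of minus this, with \<open>s = 1/p\<close>.\<close>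

definition ln_Gamma_comb :: "real \<Rightarrow> real \<Rightarrow> real" where
  "ln_Gamma_comb n s = ln_Gamma s + ln_Gamma ((n + 2) * s) - ln_Gamma (n * s) - ln_Gamma (3 * s)"

text \<open>Each \<open>ln_Gamma z\<close> is the limit of z ln N - ln z - (sum of ln (z/k + 1) for
  k = 1..N). In the combination the terms z ln N cancel, since s + (n+2)s = ns + 3s. The logarithms
  with index k merge into the k-th summand, and the terms -ln z give the summand k = 0.\<close>

lemma sums_ln_Gamma_comb:
  fixes n s :: real
  assumes n: "1 \<le> n" and s: "0 < s"
  shows "(\<lambda>k. ln ((real k / s + n) * (real k / s + 3) / ((real k / s + 1) * (real k / s + n + 2))))
    sums ln_Gamma_comb n s"
proof -
  let ?m = "\<lambda>k. ln ((real k / s + n) * (real k / s + 3) / ((real k / s + 1) * (real k / s + n + 2)))"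
  let ?L = "\<lambda>N. ln_Gamma_series s N + ln_Gamma_series ((n + 2) * s) N
      - ln_Gamma_series (n * s) N - ln_Gamma_series (3 * s) N"
  have m: "?m k = ln (n * s / k + 1) + ln (3 * s / k + 1) - ln (s / k + 1) - ln ((n + 2) * s / k + 1)"
    if "1 \<le> k" for k
  proof -
    have pos: "0 < real k" using that by simp
    have *: "ln (x * s / k + 1) = ln (real k / s + x) - ln (real k / s)" if "0 < x" for x
    proof -
      have "x * s / k + 1 = (real k / s + x) / (real k / s)"
        using pos s by (simp add: field_simps)
      moreover have "0 < real k / s" "0 < real k / s + x"
        using that pos s by (auto intro: add_pos_pos)
      ultimately show ?thesis by (simp only: ln_divide_pos)
    qed
    have "ln (s / k + 1) = ln (real k / s + 1) - ln (real k / s)"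
      using *[of 1] by simp
    moreover have "?m k = ln (real k / s + n) + ln (real k / s + 3)
        - ln (real k / s + 1) - ln (real k / s + n + 2)"
    proof -
      have "0 < real k / s" using pos s by simp
      then show ?thesis using n by (simp add: ln_divide_pos ln_mult_pos)
    qed
    ultimately show ?thesis
      using n *[of n] *[of 3] *[of "n + 2"] by (simp add: add.assoc)
  qed
  have m0: "?m 0 = ln (n * s) + ln (3 * s) - ln s - ln ((n + 2) * s)"
    using n s by (simp add: ln_div ln_mult)
  have "(\<Sum>k\<le>N. ?m k) = ?L N" for N
  proof -
    have "(\<Sum>k\<le>N. ?m k) = ?m 0 + (\<Sum>k=1..N. ?m k)"
      by (simp add: atMost_atLeast0 sum.atLeast_Suc_atMost)
    also have "(\<Sum>k=1..N. ?m k) = (\<Sum>k=1..N. ln (n * s / k + 1) + ln (3 * s / k + 1) - ln (s / k + 1) - ln ((n + 2) * s / k + 1))"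
      by (intro sum.cong refl m) auto
    finally show ?thesis
      unfolding m0 ln_Gamma_series_def by (simp add: sum.distrib sum_subtractf algebra_simps)
  qed
  moreover have "?L \<longlonglongrightarrow> ln_Gamma_comb n s"
    unfolding ln_Gamma_comb_def using n s by (intro tendsto_intros ln_Gamma_real_LIMSEQ) auto
  ultimately show ?thesis by (simp add: sums_def_le)
qed

lemma ln_Gamma_comb_term_nonneg:
  assumes n: "1 \<le> n" and s: "0 < s"
  shows "0 \<le> ln ((real k / s + n) * (real k / s + 3) / ((real k / s + 1) * (real k / s + n + 2)))"
proof -
  have v: "0 \<le> real k / s" using s by simp
  \<comment> \<open>The right side exceeds the left by 2(n - 1), whatever the value of k/s.\<close>
  have "(real k / s + 1) * (real k / s + n + 2) \<le> (real k / s + n) * (real k / s + 3)"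
    using n by (simp add: algebra_simps)
  moreover have "0 < (real k / s + 1) * (real k / s + n + 2)"
    using n v by (intro mult_pos_pos) auto
  ultimately show ?thesis by (intro ln_ge_zero) simp
qed

text \<open>Expanding 1 / (1 - exp (-u/s)) as a geometric series turns the integral into the sum of
  the Laplace transforms of the weight at k/s. These are the terms of the series for
  \<open>ln_Gamma_comb\<close>; nonnegativity permits termwise integration.\<close>

lemma nn_integral_Gamma_weight_eq_ln_Gamma_comb:
  fixes n s :: real
  assumes n: "1 \<le> n" and s: "0 < s"
  shows "(\<integral>\<^sup>+u\<in>{0<..}. ennreal (Gamma_weight n u / (1 - exp (- u / s))) \<partial>lborel)
    = ennreal (ln_Gamma_comb n s)"
proof -
  let ?m = "\<lambda>k. ln ((real k / s + n) * (real k / s + 3) / ((real k / s + 1) * (real k / s + n + 2)))"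
  let ?f = "\<lambda>k u. ennreal (exp (- (real k / s * u)) * Gamma_weight n u) * indicator {0<..} u"
  have geom: "(\<Sum>k. ?f k u) = ennreal (Gamma_weight n u / (1 - exp (- u / s))) * indicator {0<..} u" for u
  proof (cases "0 < u")
    case True
    have "exp (- u / s) < 1" using True s by simp
    then have "(\<lambda>k. exp (- u / s) ^ k * Gamma_weight n u) sums (1 / (1 - exp (- u / s)) * Gamma_weight n u)"
      by (intro sums_mult2 geometric_sums) auto
    moreover have "exp (- u / s) ^ k = exp (- (real k / s * u))" for k
      by (simp flip: exp_of_nat_mult)
    ultimately have "(\<lambda>k. exp (- (real k / s * u)) * Gamma_weight n u) sums (Gamma_weight n u / (1 - exp (- u / s)))"
      by simp
    then have "(\<Sum>k. ennreal (exp (- (real k / s * u)) * Gamma_weight n u))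
        = ennreal (Gamma_weight n u / (1 - exp (- u / s)))"
      using True n by (intro suminf_ennreal_eq) (auto simp: Gamma_weight_nonneg)
    then show ?thesis using True by simp
  qed simp
  have "(\<integral>\<^sup>+u\<in>{0<..}. ennreal (Gamma_weight n u / (1 - exp (- u / s))) \<partial>lborel)
      = (\<integral>\<^sup>+u. (\<Sum>k. ?f k u) \<partial>lborel)"
    unfolding geom ..
  also have "\<dots> = (\<Sum>k. (\<integral>\<^sup>+u. ?f k u \<partial>lborel))"
    by (intro nn_integral_suminf) measurable
  also have "\<dots> = (\<Sum>k. ennreal (?m k))"
    using n s by (intro suminf_cong nn_integral_exp_Gamma_weight) auto
  also have "\<dots> = ennreal (ln_Gamma_comb n s)"
    by (intro suminf_ennreal_eq ln_Gamma_comb_term_nonneg sums_ln_Gamma_comb n s)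
  finally show ?thesis .
qed

text \<open>Since \<open>ennreal\<close> truncates negative reals to 0, this sign is what allows the
  integral inequality below to be read back over the reals.\<close>

lemma ln_Gamma_comb_nonneg: "1 \<le> n \<Longrightarrow> 0 < s \<Longrightarrow> 0 \<le> ln_Gamma_comb n s"
  by (rule sums_le[OF ln_Gamma_comb_term_nonneg sums_zero sums_ln_Gamma_comb])

text \<open>The inequality already holds under the integral for each u > 0. There the kernel 1 / (1
  - exp (-u/r)) is the convex function of \<open>convex_on_inverse_one_minus_exp\<close> at r/u, and
  the weight is nonnegative. Only midpoints matter because 1/p and 1/q average to 1/2.\<close>

lemma ln_Gamma_comb_midpoint:
  fixes n s t :: real
  assumes n: "1 \<le> n" and s: "0 < s" and t: "0 < t"
  shows "2 * ln_Gamma_comb n ((s + t) / 2) \<le> ln_Gamma_comb n s + ln_Gamma_comb n t"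
proof -
  let ?g = "\<lambda>r u. ennreal (Gamma_weight n u / (1 - exp (- u / r))) * indicator {0<..} u"
  let ?r = "(s + t) / 2"
  have r: "0 < ?r" using s t by simp
  have le: "?g ?r u + ?g ?r u \<le> ?g s u + ?g t u" for u
  proof (cases "0 < u")
    case True
    let ?R = "\<lambda>r::real. 1 / (1 - exp (- 1 / r))"
    have "?R ((1 - 1 / 2) *\<^sub>R (s / u) + (1 / 2) *\<^sub>R (t / u)) \<le> (1 - 1 / 2) * ?R (s / u) + 1 / 2 * ?R (t / u)"
      using True s t by (intro convex_onD[OF convex_on_inverse_one_minus_exp]) auto
    moreover have arith: "2 * x \<le> a + b" if "x \<le> (1 - 1 / 2) * a + 1 / 2 * b" for x a b :: real
      using that by simp
    moreover have "(1 - 1 / 2) *\<^sub>R (s / u) + (1 / 2) *\<^sub>R (t / u) = ?r / u"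
      using True by (simp add: field_simps)
    ultimately have c: "2 * ?R (?r / u) \<le> ?R (s / u) + ?R (t / u)" 
      using arith by metis
    have R: "Gamma_weight n u / (1 - exp (- u / r)) = Gamma_weight n u * ?R (r / u)" for r by simp
    have nn: "0 \<le> Gamma_weight n u * ?R (r / u)" if "0 < r" for r
      using Gamma_weight_nonneg[OF n True] that True by simp
    have "Gamma_weight n u * (2 * ?R (?r / u)) \<le> Gamma_weight n u * (?R (s / u) + ?R (t / u))"
      by (intro mult_left_mono c Gamma_weight_nonneg n True)
    then have "Gamma_weight n u * ?R (?r / u) + Gamma_weight n u * ?R (?r / u)
        \<le> Gamma_weight n u * ?R (s / u) + Gamma_weight n u * ?R (t / u)"
      by (simp only: distrib_left mult_2)
    then show ?thesis
      unfolding R using True nn[OF s] nn[OF t] nn[OF r]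
      by (simp del: times_divide_eq_right flip: ennreal_plus)
  qed simp
  have "ennreal (ln_Gamma_comb n ?r) + ennreal (ln_Gamma_comb n ?r)
      = (\<integral>\<^sup>+u. ?g ?r u + ?g ?r u \<partial>lborel)"
    unfolding nn_integral_Gamma_weight_eq_ln_Gamma_comb[OF n r, symmetric]
    by (rule nn_integral_add[symmetric]) measurable
  also have "\<dots> \<le> (\<integral>\<^sup>+u. ?g s u + ?g t u \<partial>lborel)"
    by (intro nn_integral_mono le)
  also have "\<dots> = ennreal (ln_Gamma_comb n s) + ennreal (ln_Gamma_comb n t)"
    unfolding nn_integral_Gamma_weight_eq_ln_Gamma_comb[OF n s, symmetric]
      nn_integral_Gamma_weight_eq_ln_Gamma_comb[OF n t, symmetric]
    by (rule nn_integral_add) measurable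
  finally show ?thesis
    using ln_Gamma_comb_nonneg[OF n s] ln_Gamma_comb_nonneg[OF n t] ln_Gamma_comb_nonneg[OF n r]
    by (simp flip: ennreal_plus)
qed

subsection \<open>Volumes and second moments of the balls\<close>

lemma nn_integral_lborel_scaleR:
  fixes f :: "'a::euclidean_space \<Rightarrow> ennreal"
  assumes [measurable]: "f \<in> borel_measurable borel" and r: "0 < r"
  shows "(\<integral>\<^sup>+x. f x \<partial>lborel) = ennreal (r ^ DIM('a)) * (\<integral>\<^sup>+x. f (r *\<^sub>R x) \<partial>lborel)"
proof -
  have "(\<integral>\<^sup>+x. f x \<partial>lborel)
      = (\<integral>\<^sup>+x. f x \<partial>density (distr lborel borel (\<lambda>x. 0 + r *\<^sub>R x)) (\<lambda>_. \<bar>r\<bar> ^ DIM('a)))"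
    using r by (subst lborel_affine[of r 0]) auto
  then show ?thesis
    using r by (simp add: nn_integral_density nn_integral_distr nn_integral_cmult)
qed

lemma nn_integral_exp_atLeast:
  "(\<integral>\<^sup>+t. ennreal (exp (- t)) * indicator {a..} t \<partial>lborel) = ennreal (exp (- a))" for a :: real
proof -
  have "(\<integral>\<^sup>+t. ennreal (exp (- t)) * indicator {a..} t \<partial>lborel) = ennreal (0 - (- exp (- a)))"
  proof (rule nn_integral_FTC_atLeast)
    have "((\<lambda>t::real. exp (- t)) \<longlongrightarrow> 0) at_top"
      by (intro filterlim_compose[OF exp_at_bot] filterlim_uminus_at_bot_at_top)
    from tendsto_minus[OF this] show "((\<lambda>t::real. - exp (- t)) \<longlongrightarrow> 0) at_top" by simp
    show "((\<lambda>t. - exp (- t)) has_real_derivative exp (- t)) (at t)" for t :: real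
      by (auto intro!: derivative_eq_intros)
  qed auto
  then show ?thesis by simp
qed

text \<open>Integrating over the level sets of \<open>S\<close>, all of which are dilates of the unit level set.\<close>

lemma nn_integral_exp_homogeneous:
  fixes S f :: "'a::euclidean_space \<Rightarrow> real" and p d :: real
  assumes p: "0 < p" and d: "0 \<le> d"
    and [measurable]: "S \<in> borel_measurable borel" "f \<in> borel_measurable borel"
    and S: "\<And>x. 0 \<le> S x" "\<And>r x. 0 < r \<Longrightarrow> S (r *\<^sub>R x) = r powr p * S x"
    and f: "\<And>x. 0 \<le> f x" "\<And>r x. 0 < r \<Longrightarrow> f (r *\<^sub>R x) = r powr d * f x"
  shows "(\<integral>\<^sup>+x. ennreal (f x * exp (- S x)) \<partial>lborel)
    = ennreal (Gamma ((real DIM('a) + d) / p + 1)) * (\<integral>\<^sup>+x\<in>{x. S x \<le> 1}. ennreal (f x) \<partial>lborel)"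
proof -
  let ?C = "\<integral>\<^sup>+x\<in>{x. S x \<le> 1}. ennreal (f x) \<partial>lborel"
  let ?e = "(real DIM('a) + d) / p"
  \<comment> \<open>Dilation by r = t^(1/p) carries the unit level set to level t. The Jacobian
    r^DIM and the factor r^d from f combine to t^((DIM + d)/p).\<close>
  have level: "(\<integral>\<^sup>+x. ennreal (f x) * indicator {x. S x \<le> t} x \<partial>lborel) = ennreal (t powr ?e) * ?C"
    if t: "0 < t" for t
  proof -
    define r where "r = t powr (1 / p)"
    have r: "0 < r" "r powr p = t" using t p by (auto simp: r_def powr_powr)
    have "ennreal (f (r *\<^sub>R x)) * indicator {x. S x \<le> t} (r *\<^sub>R x)
        = ennreal (r powr d) * (ennreal (f x) * indicator {x. S x \<le> 1} x)" for x
      using r t f(1)[of x] by (auto simp: S f indicator_def ennreal_mult)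
    then have "(\<integral>\<^sup>+x. ennreal (f x) * indicator {x. S x \<le> t} x \<partial>lborel)
        = ennreal (r ^ DIM('a)) * (ennreal (r powr d) * ?C)"
      by (subst nn_integral_lborel_scaleR[OF _ r(1)]) (simp_all add: nn_integral_cmult)
    moreover have "r ^ DIM('a) * r powr d = t powr ?e"
      using r t p by (simp add: r_def powr_powr flip: powr_realpow powr_add add_divide_distrib)
    ultimately show ?thesis
      using r by (simp add: mult.assoc[symmetric] ennreal_mult[symmetric])
  qed
  \<comment> \<open>Layer cake: exp (-S x) is the integral of exp (-t) over t \<ge> S x. After
    exchanging the integrals, \<open>level\<close> leaves Euler's integral for Gamma in t.\<close>
  have "(\<integral>\<^sup>+x. ennreal (f x * exp (- S x)) \<partial>lborel)
      = (\<integral>\<^sup>+x. (\<integral>\<^sup>+t. ennreal (f x) * (ennreal (exp (- t)) * indicator {S x..} t) \<partial>lborel) \<partial>lborel)"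
    using f(1) by (intro nn_integral_cong)
      (simp add: nn_integral_cmult nn_integral_exp_atLeast ennreal_mult)
  also have "\<dots> = (\<integral>\<^sup>+t. (\<integral>\<^sup>+x. ennreal (f x) * (ennreal (exp (- t)) * indicator {S x..} t) \<partial>lborel) \<partial>lborel)"
  proof -
    \<comment> \<open>The indicator of an x-dependent interval is rewritten as a condition on the
      pair (x, t), which makes joint measurability evident.\<close>
    have "(\<lambda>(x, t). ennreal (f x) * (ennreal (exp (- t)) * (if S x \<le> t then 1 else 0)))
        \<in> borel_measurable (lborel \<Otimes>\<^sub>M lborel)"
      by measurable
    then show ?thesis
      by (intro lborel_pair.Fubini'[symmetric]) (simp add: indicator_def split_beta' of_bool_def)
  qed
  also have "\<dots> = (\<integral>\<^sup>+t. ennreal (indicator {0..} t * t powr (?e + 1 - 1) / exp t) * ?C \<partial>lborel)"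
  \<comment> \<open>The point t = 0 is discarded as a null set: the zero level set is not a dilate
    of the unit one. For t < 0 both sides vanish.\<close>
  proof (rule nn_integral_cong_AE)
    have *: "(\<integral>\<^sup>+x. ennreal (f x) * (ennreal (exp (- t)) * indicator {S x..} t) \<partial>lborel)
        = ennreal (indicator {0..} t * t powr (?e + 1 - 1) / exp t) * ?C" if "t \<noteq> 0" for t
    proof (cases "0 < t")
      case True
      have "(\<integral>\<^sup>+x. ennreal (f x) * (ennreal (exp (- t)) * indicator {S x..} t) \<partial>lborel)
          = (\<integral>\<^sup>+x. ennreal (exp (- t)) * (ennreal (f x) * indicator {x. S x \<le> t} x) \<partial>lborel)"
        by (intro nn_integral_cong) (auto simp: indicator_def mult.commute)
      also have "\<dots> = ennreal (exp (- t)) * (ennreal (t powr ?e) * ?C)"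
        by (subst nn_integral_cmult) (simp_all add: level[OF True])
      also have "\<dots> = ennreal (exp (- t) * t powr ?e) * ?C"
        by (simp only: ennreal_mult exp_ge_zero powr_ge_zero mult.assoc)
      also have "exp (- t) * t powr ?e = indicator {0..} t * t powr (?e + 1 - 1) / exp t"
        using True by (simp add: exp_minus divide_inverse mult.commute)
      finally show ?thesis .
    next
      case False
      then have "indicator {S x..} t = (0::ennreal)" for x
        using S(1)[of x] that by (auto simp: indicator_def)
      with False that show ?thesis by simp
    qed
    show "AE t in lborel. (\<integral>\<^sup>+x. ennreal (f x) * (ennreal (exp (- t)) * indicator {S x..} t) \<partial>lborel)
        = ennreal (indicator {0..} t * t powr (?e + 1 - 1) / exp t) * ?C"
      using AE_lborel_singleton[of "0::real"] by eventually_elim (rule *)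
  qed
  also have "\<dots> = ennreal (Gamma (?e + 1)) * ?C"
  proof -
    have "0 \<le> ?e" using p d by simp
    then show ?thesis
      by (subst nn_integral_multc, measurable) (subst Gamma_conv_nn_integral_real[of "?e + 1"], auto)
  qed
  finally show ?thesis .
qed

lemma nn_integral_sq_Icc: "(\<integral>\<^sup>+x\<in>{-1..1::real}. ennreal (x\<^sup>2) \<partial>lborel) = ennreal (2 / 3)"
proof -
  have "(\<integral>\<^sup>+(x::real). ennreal (x\<^sup>2) * indicator {-1..1} x \<partial>lborel) = ennreal (1 ^ 3 / 3 - (- 1) ^ 3 / 3)"
    by (intro nn_integral_FTC_Icc) (auto intro!: derivative_eq_intros)
  then show ?thesis by simp
qed

lemma abs_powr_le_1_iff: "0 < p \<Longrightarrow> \<bar>x\<bar> powr p \<le> 1 \<longleftrightarrow> \<bar>x\<bar> \<le> 1" for x p :: real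
  using powr_le1[of p "\<bar>x\<bar>"] gr_one_powr[of "\<bar>x\<bar>" p] by linarith

text \<open>This is the homogeneous formula on the line, where the unit level set is [-1, 1] for
  every p; the degrees of f are 0 and 2.\<close>

lemma nn_integral_exp_abs_powr:
  fixes p :: real
  assumes p: "0 < p"
  shows "(\<integral>\<^sup>+x. ennreal (exp (- (\<bar>x\<bar> powr p))) \<partial>lborel) = ennreal (2 * Gamma (1 / p + 1))"
    and "(\<integral>\<^sup>+x. ennreal (x\<^sup>2 * exp (- (\<bar>x\<bar> powr p))) \<partial>lborel) = ennreal (2 / 3 * Gamma (3 / p + 1))"
proof -
  have ball: "{x. \<bar>x\<bar> powr p \<le> 1} = {-1..1::real}"
    using p by (auto simp: abs_powr_le_1_iff)
  have pos: "0 < Gamma (1 / p + 1)" "0 < Gamma (3 / p + 1)"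
    using p by (auto intro!: add_pos_pos)
  have "(\<integral>\<^sup>+x. ennreal (1 * exp (- (\<bar>x\<bar> powr p))) \<partial>lborel)
      = ennreal (Gamma ((real DIM(real) + 0) / p + 1)) * (\<integral>\<^sup>+x\<in>{x::real. \<bar>x\<bar> powr p \<le> 1}. ennreal 1 \<partial>lborel)"
    using p by (intro nn_integral_exp_homogeneous) (auto simp: abs_mult powr_mult)
  then show "(\<integral>\<^sup>+x. ennreal (exp (- (\<bar>x\<bar> powr p))) \<partial>lborel) = ennreal (2 * Gamma (1 / p + 1))"
    using pos by (simp add: ball ennreal_mult mult.commute)
  have "(\<integral>\<^sup>+x. ennreal (x\<^sup>2 * exp (- (\<bar>x\<bar> powr p))) \<partial>lborel)
      = ennreal (Gamma ((real DIM(real) + 2) / p + 1)) * (\<integral>\<^sup>+x\<in>{x::real. \<bar>x\<bar> powr p \<le> 1}. ennreal (x\<^sup>2) \<partial>lborel)"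
    using p by (intro nn_integral_exp_homogeneous) (auto simp: abs_mult powr_mult power_mult_distrib)
  also have "\<dots> = ennreal (2 / 3 * Gamma (3 / p + 1))"
    unfolding ball nn_integral_sq_Icc using pos by (simp add: mult.commute flip: ennreal_mult)
  finally show "(\<integral>\<^sup>+x. ennreal (x\<^sup>2 * exp (- (\<bar>x\<bar> powr p))) \<partial>lborel) = ennreal (2 / 3 * Gamma (3 / p + 1))" .
qed

text \<open>Summing over \<open>Basis\<close> of a general Euclidean space matches the product
  formula for \<open>lborel\<close>; \<open>lp_ball_eq_powr_ball\<close> later makes the link with
  \<open>lp_ball\<close>.\<close>

definition powr_sum :: "real \<Rightarrow> 'a::euclidean_space \<Rightarrow> real" where
  "powr_sum p x = (\<Sum>b\<in>Basis. \<bar>x \<bullet> b\<bar> powr p)"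

definition powr_ball :: "real \<Rightarrow> 'a::euclidean_space set" where
  "powr_ball p = {x. powr_sum p x \<le> 1}"

lemma powr_sum_nonneg: "0 \<le> powr_sum p x"
  unfolding powr_sum_def by (intro sum_nonneg) auto

lemma powr_sum_scaleR: "0 < r \<Longrightarrow> powr_sum p (r *\<^sub>R x) = r powr p * powr_sum p x"
  by (simp add: powr_sum_def abs_mult powr_mult sum_distrib_left)

lemma powr_sum_measurable [measurable]: "powr_sum p \<in> borel_measurable borel"
  unfolding powr_sum_def by measurable

text \<open>The exponential of a sum factors over the coordinates, so both integrals are products of
  one-dimensional ones. The square alters only the factor of index i.\<close>

lemma nn_integral_exp_powr_sum:
  fixes p :: real
  assumes p: "0 < p"
  shows "(\<integral>\<^sup>+(x::'a::euclidean_space). ennreal (exp (- powr_sum p x)) \<partial>lborel)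
    = ennreal ((2 * Gamma (1 / p + 1)) ^ DIM('a))" (is ?A)
    and "i \<in> Basis \<Longrightarrow> (\<integral>\<^sup>+(x::'a). ennreal ((x \<bullet> i)\<^sup>2 * exp (- powr_sum p x)) \<partial>lborel)
      = ennreal (2 / 3 * Gamma (3 / p + 1) * (2 * Gamma (1 / p + 1)) ^ (DIM('a) - 1))" (is "_ \<Longrightarrow> ?B")
proof -
  have pos: "0 < Gamma (1 / p + 1)" "0 < Gamma (3 / p + 1)"
    using p by (auto intro!: add_pos_pos)
  have expS: "ennreal (exp (- powr_sum p x)) = (\<Prod>b\<in>Basis. ennreal (exp (- (\<bar>x \<bullet> b\<bar> powr p))))" for x :: 'a
    by (simp add: powr_sum_def prod_ennreal exp_sum sum_negf[symmetric])
  show ?A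
    unfolding expS using p pos
    by (subst nn_integral_lborel_prod) (auto simp: nn_integral_exp_abs_powr ennreal_power)
  assume i: "i \<in> Basis"
  have "(\<Prod>b\<in>Basis. (if b = i then ennreal ((x \<bullet> b)\<^sup>2) else 1)) = ennreal ((x \<bullet> i)\<^sup>2)" for x :: 'a
    using i by simp
  then have "(\<integral>\<^sup>+(x::'a). ennreal ((x \<bullet> i)\<^sup>2 * exp (- powr_sum p x)) \<partial>lborel)
      = (\<integral>\<^sup>+(x::'a). (\<Prod>b\<in>Basis. (if b = i then ennreal ((x \<bullet> b)\<^sup>2) else 1) * ennreal (exp (- (\<bar>x \<bullet> b\<bar> powr p)))) \<partial>lborel)"
    by (simp add: prod.distrib expS ennreal_mult)
  also have "\<dots> = (\<Prod>b\<in>Basis. (\<integral>\<^sup>+t. (if b = i then ennreal (t\<^sup>2) else 1) * ennreal (exp (- (\<bar>t\<bar> powr p))) \<partial>lborel))"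
    by (rule nn_integral_lborel_prod) auto
  also have "\<dots> = (\<Prod>b\<in>Basis. if b = i then ennreal (2 / 3 * Gamma (3 / p + 1)) else ennreal (2 * Gamma (1 / p + 1)))"
    using nn_integral_exp_abs_powr[OF p] by (intro prod.cong) (auto simp flip: ennreal_mult')
  also have "\<dots> = ennreal (2 / 3 * Gamma (3 / p + 1)) * (\<Prod>b\<in>Basis - {i}. ennreal (2 * Gamma (1 / p + 1)))"
    using i by (subst prod.remove[OF _ i]) (auto intro!: arg_cong2[where f="(*)"] prod.cong)
  also have "\<dots> = ennreal (2 / 3 * Gamma (3 / p + 1) * (2 * Gamma (1 / p + 1)) ^ (DIM('a) - 1))"
    using i pos by (simp add: ennreal_power ennreal_mult[symmetric] card_Diff_singleton)
  finally show ?B .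
qed

text \<open>Closed form of the mean of a squared coordinate over \<open>powr_ball p\<close> in
  dimension n, as \<open>set_integral_sq_powr_ball\<close> shows.\<close>

definition ball_ratio :: "nat \<Rightarrow> real \<Rightarrow> real" where
  "ball_ratio n p = Gamma (3 / p + 1) * Gamma (n / p + 1) / (3 * Gamma (1 / p + 1) * Gamma ((real n + 2) / p + 1))"

text \<open>The integral of exp (-\<open>powr_sum p\<close>) is evaluated twice: by level sets as a
  Gamma value times the volume, and as a product over the coordinates.\<close>

lemma measure_powr_ball:
  assumes p: "0 < p"
  shows "measure lborel (powr_ball p :: 'a::euclidean_space set)
    = (2 * Gamma (1 / p + 1)) ^ DIM('a) / Gamma (DIM('a) / p + 1)" (is "measure _ ?B = ?v")
proof -
  have pos: "0 < Gamma (1 / p + 1)" "0 < Gamma (DIM('a) / p + 1)"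
    using p by (auto intro!: add_pos_pos)
  have [measurable]: "?B \<in> sets lborel" unfolding powr_ball_def by measurable
  have "(\<integral>\<^sup>+(x::'a). ennreal (1 * exp (- powr_sum p x)) \<partial>lborel)
    = ennreal (Gamma ((real DIM('a) + 0) / p + 1)) * (\<integral>\<^sup>+x\<in>{x::'a. powr_sum p x \<le> 1}. ennreal 1 \<partial>lborel)"
    using p by (intro nn_integral_exp_homogeneous) (auto simp: powr_sum_nonneg powr_sum_scaleR)
  then have e: "ennreal (Gamma (DIM('a) / p + 1)) * emeasure lborel ?B = ennreal ((2 * Gamma (1 / p + 1)) ^ DIM('a))"
    using p by (simp add: nn_integral_exp_powr_sum powr_ball_def)
  then have "Gamma (DIM('a) / p + 1) * measure lborel ?B = (2 * Gamma (1 / p + 1)) ^ DIM('a)"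
    using pos by (metis Sigma_Algebra.measure_def enn2real_mult enn2real_ennreal less_imp_le zero_le_power mult_nonneg_nonneg zero_le_numeral)
  then show ?thesis using pos by (simp add: field_simps)
qed

text \<open>The same double evaluation with a weight of degree 2. One of the DIM coordinate factors
  is now 2/3 Gamma(3/p + 1) instead of 2 Gamma(1/p + 1), hence the 3 in the denominator of
  \<open>ball_ratio\<close>.\<close>

lemma set_integral_sq_powr_ball:
  assumes p: "0 < p" and i: "(i::'a::euclidean_space) \<in> Basis"
  shows "(LINT x:powr_ball p|lborel. (x \<bullet> i)\<^sup>2) = ball_ratio DIM('a) p * measure lborel (powr_ball p :: 'a set)"
    (is "?I = _")
proof -
  have pos: "0 < Gamma (1 / p + 1)" "0 < Gamma (3 / p + 1)" "0 < Gamma ((real DIM('a) + 2) / p + 1)"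
    "0 < Gamma (DIM('a) / p + 1)"
    using p by (auto intro!: add_pos_pos)
  have [measurable]: "(powr_ball p :: 'a set) \<in> sets lborel" unfolding powr_ball_def by measurable
  let ?J = "\<integral>\<^sup>+x\<in>(powr_ball p :: 'a set). ennreal ((x \<bullet> i)\<^sup>2) \<partial>lborel"
  have "(\<integral>\<^sup>+(x::'a). ennreal ((x \<bullet> i)\<^sup>2 * exp (- powr_sum p x)) \<partial>lborel)
    = ennreal (Gamma ((real DIM('a) + 2) / p + 1)) * (\<integral>\<^sup>+x\<in>{x::'a. powr_sum p x \<le> 1}. ennreal ((x \<bullet> i)\<^sup>2) \<partial>lborel)"
    using p by (intro nn_integral_exp_homogeneous)
      (auto simp: powr_sum_nonneg powr_sum_scaleR power_mult_distrib)
  then have e: "ennreal (Gamma ((real DIM('a) + 2) / p + 1)) * ?J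
      = ennreal (2 / 3 * Gamma (3 / p + 1) * (2 * Gamma (1 / p + 1)) ^ (DIM('a) - 1))"
    unfolding nn_integral_exp_powr_sum(2)[OF p i] powr_ball_def by simp
  have "Gamma ((real DIM('a) + 2) / p + 1) * enn2real ?J
      = enn2real (ennreal (Gamma ((real DIM('a) + 2) / p + 1)) * ?J)"
    using pos by (simp add: enn2real_mult)
  also have "\<dots> = 2 / 3 * Gamma (3 / p + 1) * (2 * Gamma (1 / p + 1)) ^ (DIM('a) - 1)"
    unfolding e using pos by simp
  also have "enn2real ?J = ?I"
    unfolding set_lebesgue_integral_def
    by (subst integral_eq_nn_integral) (auto intro!: arg_cong[where f=enn2real] nn_integral_cong simp: indicator_def)
  finally have "Gamma ((real DIM('a) + 2) / p + 1) * ?I = 2 / 3 * Gamma (3 / p + 1) * (2 * Gamma (1 / p + 1)) ^ (DIM('a) - 1)" .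
  moreover have "(2 * Gamma (1 / p + 1)) ^ DIM('a) = 2 * Gamma (1 / p + 1) * (2 * Gamma (1 / p + 1)) ^ (DIM('a) - 1)"
    by (metis DIM_positive power_eq_if less_numeral_extra(3))
  ultimately show ?thesis
    unfolding measure_powr_ball[OF p] ball_ratio_def using pos by (simp add: field_simps)
qed

lemma measure_cube: "measure lborel (cbox (- One) One :: 'a::euclidean_space set) = 2 ^ DIM('a)"
proof -
  have "(\<Prod>b\<in>Basis. (One - - One :: 'a) \<bullet> b) = (\<Prod>b\<in>(Basis :: 'a set). 2)"
    by (intro prod.cong) (simp_all add: algebra_simps)
  then show ?thesis
    by (subst measure_lborel_cbox_eq) simp_all
qed

text \<open>For p = \<infinity> no Gamma integral is involved: the indicator of the cube factors,
  and the mean of t^2 over [-1, 1] is 1/3.\<close>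

lemma set_integral_sq_cube:
  assumes i: "(i::'a::euclidean_space) \<in> Basis"
  shows "(LINT x:cbox (- One) One|lborel. (x \<bullet> i)\<^sup>2) = 1 / 3 * measure lborel (cbox (- One) One :: 'a set)"
proof -
  have ind: "(\<Prod>b\<in>Basis. indicator {-1..1} (x \<bullet> b)) = (indicator (cbox (- One) One) x :: ennreal)" for x :: 'a
    by (auto simp: indicator_def mem_box prod_ennreal)
  have sq: "(\<Prod>b\<in>Basis. (if b = i then ennreal ((x \<bullet> b)\<^sup>2) else 1)) = ennreal ((x \<bullet> i)\<^sup>2)" for x :: 'a
    using i by simp
  have "(\<integral>\<^sup>+(x::'a). ennreal ((x \<bullet> i)\<^sup>2) * indicator (cbox (- One) One) x \<partial>lborel)
      = (\<integral>\<^sup>+(x::'a). (\<Prod>b\<in>Basis. (if b = i then ennreal ((x \<bullet> b)\<^sup>2) else 1) * indicator {-1..1} (x \<bullet> b)) \<partial>lborel)"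
    by (simp only: prod.distrib ind sq)
  also have "\<dots> = (\<Prod>b\<in>Basis. (\<integral>\<^sup>+t. (if b = i then ennreal (t\<^sup>2) else 1) * indicator {-1..1} t \<partial>lborel))"
    by (rule nn_integral_lborel_prod) auto
  also have "\<dots> = (\<Prod>b\<in>Basis. if b = i then ennreal (2 / 3) else ennreal 2)"
    by (intro prod.cong) (auto simp: nn_integral_sq_Icc)
  also have "\<dots> = ennreal (2 / 3) * (\<Prod>b\<in>Basis - {i}. ennreal 2)"
    using i by (subst prod.remove[OF _ i]) (auto intro!: arg_cong2[where f="(*)"] prod.cong)
  also have "\<dots> = ennreal (2 / 3 * 2 ^ (DIM('a) - 1))"
    using i by (subst prod_ennreal) (auto simp: ennreal_mult[symmetric] card_Diff_singleton)
  finally have e: "(\<integral>\<^sup>+(x::'a). ennreal ((x \<bullet> i)\<^sup>2) * indicator (cbox (- One) One) x \<partial>lborel)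
      = ennreal (2 / 3 * 2 ^ (DIM('a) - 1))" .
  have "(LINT x:cbox (- One) One|lborel. (x \<bullet> i)\<^sup>2)
      = enn2real (\<integral>\<^sup>+(x::'a). ennreal ((x \<bullet> i)\<^sup>2) * indicator (cbox (- One) One) x \<partial>lborel)"
    unfolding set_lebesgue_integral_def
    by (subst integral_eq_nn_integral) (auto intro!: arg_cong[where f=enn2real] nn_integral_cong simp: indicator_def)
  moreover have "(2::real) ^ DIM('a) = 2 * 2 ^ (DIM('a) - 1)"
    by (metis DIM_positive power_eq_if less_numeral_extra(3))
  ultimately show ?thesis unfolding e measure_cube by simp
qed

subsection \<open>Polarity and reflection symmetry\<close>

text \<open>The map is diagonal with one entry -1 and all others 1, so the absolute value of its
  determinant is 1.\<close>

lemma lborel_distr_reflection: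
  assumes i: "(i::'a::euclidean_space) \<in> Basis"
  shows "distr lborel borel (\<lambda>x. x - (2 * (x \<bullet> i)) *\<^sub>R i) = lborel"
proof -
  define c where "c = (\<lambda>j::'a. if j = i then - 1 else (1::real))"
  have "(\<lambda>x. 0 + (\<Sum>j\<in>Basis. (c j * (x \<bullet> j)) *\<^sub>R j)) = (\<lambda>x. x - (2 * (x \<bullet> i)) *\<^sub>R i)"
  proof
    fix x :: 'a
    have "(\<Sum>j\<in>Basis. (c j * (x \<bullet> j)) *\<^sub>R j)
        = (\<Sum>j\<in>Basis. (x \<bullet> j) *\<^sub>R j - (if j = i then (2 * (x \<bullet> j)) *\<^sub>R j else 0))"
      by (intro sum.cong) (auto simp: c_def scaleR_left_diff_distrib[symmetric])
    also have "\<dots> = x - (2 * (x \<bullet> i)) *\<^sub>R i"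
      using i by (simp add: sum_subtractf euclidean_representation)
    finally show "0 + (\<Sum>j\<in>Basis. (c j * (x \<bullet> j)) *\<^sub>R j) = x - (2 * (x \<bullet> i)) *\<^sub>R i" by simp
  qed
  moreover have "(\<Prod>j\<in>Basis. \<bar>c j\<bar>) = 1"
    by (intro prod.neutral) (auto simp: c_def)
  ultimately show ?thesis
    using lborel_affine_euclidean[of c 0] by (simp add: c_def density_1)
qed

text \<open>The map in the body flips the sign of the i-th coordinate. As it is an involution,
  mapping K into itself already means mapping K onto itself.\<close>

definition unconditional :: "'a::euclidean_space set \<Rightarrow> bool" where
  "unconditional K \<longleftrightarrow> (\<forall>i\<in>Basis. \<forall>x\<in>K. x - (2 * (x \<bullet> i)) *\<^sub>R i \<in> K)"

text \<open>Reflecting the i-th coordinate preserves K and Lebesgue measure but negates the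
  integrand, so the integral equals its own negative.\<close>

lemma set_integral_mixed_unconditional:
  fixes K :: "'a::euclidean_space set"
  assumes K: "unconditional K" "compact K"
    and ij: "i \<in> Basis" "j \<in> Basis" "i \<noteq> j"
  shows "(LINT x:K|lborel. (x \<bullet> i) * (x \<bullet> j)) = 0"
proof -
  let ?T = "\<lambda>x::'a. x - (2 * (x \<bullet> i)) *\<^sub>R i"
  have [measurable]: "K \<in> sets borel" using K by (simp add: borel_compact)
  have TT: "?T (?T x) = x" for x
    using ij by (simp add: algebra_simps)
  have TK: "?T x \<in> K \<longleftrightarrow> x \<in> K" for x
    using K(1) ij TT[of x] unfolding unconditional_def by metis
  have "(LINT x:K|lborel. (x \<bullet> i) * (x \<bullet> j))
      = (LINT x|distr lborel borel ?T. indicator K x *\<^sub>R ((x \<bullet> i) * (x \<bullet> j)))"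
    unfolding set_lebesgue_integral_def lborel_distr_reflection[OF ij(1)] ..
  also have "\<dots> = (LINT x|lborel. indicator K (?T x) *\<^sub>R ((?T x \<bullet> i) * (?T x \<bullet> j)))"
    by (rule integral_distr) measurable
  also have "\<dots> = (LINT x|lborel. - (indicator K x *\<^sub>R ((x \<bullet> i) * (x \<bullet> j))))"
    using ij by (intro Bochner_Integration.integral_cong refl)
      (simp add: indicator_def TK inner_diff_left inner_Basis)
  also have "\<dots> = - (LINT x:K|lborel. (x \<bullet> i) * (x \<bullet> j))"
    unfolding set_lebesgue_integral_def by simp
  finally show ?thesis by simp
qed

text \<open>Expanding the square gives a double sum of second moments of K; the mixed ones vanish by
  symmetry and the diagonal ones all equal m.\<close>

lemma set_integral_inner_sq_unconditional:
  fixes K :: "'a::euclidean_space set"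
  assumes K: "unconditional K" "compact K"
    and m: "\<And>i. i \<in> Basis \<Longrightarrow> (LINT x:K|lborel. (x \<bullet> i)\<^sup>2) = m"
  shows "(LINT y:K|lborel. (x \<bullet> y)\<^sup>2) = m * (norm x)\<^sup>2"
proof -
  have int: "integrable lborel (\<lambda>y. indicator K y *\<^sub>R ((y \<bullet> i) * (y \<bullet> j)))" for i j :: 'a
    by (intro borel_integrable_compact K continuous_intros)
  have "(LINT y:K|lborel. (x \<bullet> y)\<^sup>2)
      = (LINT y|lborel. (\<Sum>i\<in>Basis. \<Sum>j\<in>Basis. ((x \<bullet> i) * (x \<bullet> j)) * (indicator K y *\<^sub>R ((y \<bullet> i) * (y \<bullet> j)))))"
    unfolding set_lebesgue_integral_def
    by (intro Bochner_Integration.integral_cong refl, subst euclidean_inner)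
      (simp add: power2_eq_square sum_product sum_distrib_left ac_simps)
  also have "\<dots> = (\<Sum>i\<in>Basis. \<Sum>j\<in>Basis. ((x \<bullet> i) * (x \<bullet> j)) * (LINT y:K|lborel. (y \<bullet> i) * (y \<bullet> j)))"
    unfolding set_lebesgue_integral_def
    using int by (simp add: Bochner_Integration.integral_sum)
  also have "\<dots> = (\<Sum>i\<in>Basis. \<Sum>j\<in>Basis. if i = j then (x \<bullet> i)\<^sup>2 * m else 0)"
    by (intro sum.cong refl)
      (auto simp: set_integral_mixed_unconditional[OF K] m power2_eq_square[symmetric])
  also have "\<dots> = (\<Sum>i\<in>Basis. (x \<bullet> i)\<^sup>2 * m)"
    by simp
  also have "\<dots> = m * (norm x)\<^sup>2"
    unfolding power2_norm_eq_inner euclidean_inner[of x x]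
    by (simp add: sum_distrib_left power2_eq_square mult.commute)
  finally show ?thesis .
qed

text \<open>The inner integral is c |K\<degree>| times the squared norm of x, by the preceding
  lemma. Integrating this over K adds up DIM equal second moments a |K|, and the volumes cancel
  against the normalization.\<close>

lemma phi_unconditional:
  fixes K :: "'a::euclidean_space set" and a c :: real
  assumes K: "unconditional K" "compact K" "0 < measure lborel K"
    and L: "unconditional (polar_body K)" "compact (polar_body K)" "0 < measure lborel (polar_body K)"
    and a: "\<And>i. i \<in> Basis \<Longrightarrow> (LINT x:K|lborel. (x \<bullet> i)\<^sup>2) = a * measure lborel K"
    and c: "\<And>i. i \<in> Basis \<Longrightarrow> (LINT x:polar_body K|lborel. (x \<bullet> i)\<^sup>2) = c * measure lborel (polar_body K)"
  shows "phi K = DIM('a) * a * c"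
proof -
  let ?m = "c * measure lborel (polar_body K)"
  have int: "integrable lborel (\<lambda>x. indicator K x *\<^sub>R (x \<bullet> i)\<^sup>2)" for i :: 'a
    by (intro borel_integrable_compact K continuous_intros)
  have inner: "(LINT y:polar_body K|lborel. (x \<bullet> y)\<^sup>2) = ?m * (norm x)\<^sup>2" for x
    by (rule set_integral_inner_sq_unconditional[OF L(1,2) c])
  have "(LINT x:K|lborel. (LINT y:polar_body K|lborel. (x \<bullet> y)\<^sup>2)) = (LINT x:K|lborel. ?m * (norm x)\<^sup>2)"
    by (simp only: inner)
  also have "\<dots> = ?m * (LINT x|lborel. (\<Sum>i\<in>Basis. indicator K x *\<^sub>R (x \<bullet> i)\<^sup>2))"
  proof -
    have "(norm x)\<^sup>2 = (\<Sum>i\<in>Basis. (x \<bullet> i)\<^sup>2)" for x :: 'a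
      unfolding power2_norm_eq_inner by (subst euclidean_inner) (simp add: power2_eq_square)
    then have "indicator K x *\<^sub>R (?m * (norm x)\<^sup>2) = ?m * (\<Sum>i\<in>Basis. indicator K x *\<^sub>R (x \<bullet> i)\<^sup>2)" for x
      by (cases "x \<in> K") simp_all
    then show ?thesis by (simp only: set_lebesgue_integral_def integral_mult_right_zero)
  qed
  also have "\<dots> = ?m * (\<Sum>i\<in>Basis. LINT x:K|lborel. (x \<bullet> i)\<^sup>2)"
    unfolding set_lebesgue_integral_def using int by (subst Bochner_Integration.integral_sum) auto
  also have "\<dots> = ?m * (DIM('a) * (a * measure lborel K))"
    by (simp add: a)
  finally show ?thesis
    unfolding phi_def using K(3) L(3) by (simp add: field_simps)
qed

lemma unconditional_powr_ball: "unconditional (powr_ball p)"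
proof -
  have "powr_sum p (x - (2 * (x \<bullet> i)) *\<^sub>R i) = powr_sum p x" if "i \<in> Basis" for x i :: 'a
    unfolding powr_sum_def using that
    by (intro sum.cong refl) (auto simp: inner_diff_left inner_Basis)
  then show ?thesis by (simp add: unconditional_def powr_ball_def)
qed

lemma mem_cube_iff: "x \<in> cbox (- One) One \<longleftrightarrow> (\<forall>b\<in>Basis. \<bar>x \<bullet> b\<bar> \<le> 1)"
  by (auto simp: mem_box abs_le_iff minus_le_iff)

lemma unconditional_cube: "unconditional (cbox (- One) One)"
  by (auto simp: unconditional_def mem_cube_iff inner_diff_left inner_Basis)

lemma powr_ball_subset_cube:
  assumes "0 < p"
  shows "powr_ball p \<subseteq> cbox (- One) One"
proof
  fix x :: 'a
  assume "x \<in> powr_ball p"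
  then have x: "(\<Sum>b\<in>Basis. \<bar>x \<bullet> b\<bar> powr p) \<le> 1" by (simp add: powr_ball_def powr_sum_def)
  have "\<bar>x \<bullet> b\<bar> \<le> 1" if b: "b \<in> Basis" for b
  proof -
    have "\<bar>x \<bullet> b\<bar> powr p \<le> (\<Sum>b\<in>Basis. \<bar>x \<bullet> b\<bar> powr p)"
      using b by (intro member_le_sum) auto
    with x have "\<bar>x \<bullet> b\<bar> powr p \<le> 1" by linarith
    then show ?thesis by (simp add: abs_powr_le_1_iff[OF assms])
  qed
  then show "x \<in> cbox (- One) One"
    by (simp add: mem_cube_iff)
qed

lemma compact_powr_ball:
  assumes p: "0 < p"
  shows "compact (powr_ball p)"
proof -
  have "continuous_on UNIV (powr_sum p :: 'a \<Rightarrow> real)"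
    unfolding powr_sum_def using p by (intro continuous_on_sum continuous_on_powr' continuous_intros) auto
  then have "closed (powr_ball p :: 'a set)"
    unfolding powr_ball_def by (intro closed_Collect_le) auto
  then show ?thesis
    using bounded_subset[OF bounded_cbox powr_ball_subset_cube[OF p]] by (simp add: compact_eq_bounded_closed)
qed

lemma measure_powr_ball_pos: "0 < p \<Longrightarrow> 0 < measure lborel (powr_ball p)"
  by (auto simp: measure_powr_ball intro!: divide_pos_pos zero_less_power mult_pos_pos add_nonneg_pos)

text \<open>Young's inequality, summed over the coordinates, puts \<open>powr_ball q\<close> inside
  the polar. Conversely, a point outside \<open>powr_ball q\<close> is excluded by testing it
  against the equality case of Hoelder's inequality.\<close>

lemma polar_powr_ball:
  assumes pq: "1 < p" "1 < q" "1 / p + 1 / q = 1"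
  shows "polar_body (powr_ball p :: 'a::euclidean_space set) = powr_ball q"
proof (intro set_eqI iffI)
  fix x :: 'a
  assume "x \<in> powr_ball q"
  then have x: "powr_sum q x \<le> 1" by (simp add: powr_ball_def)
  have "x \<bullet> y \<le> 1" if "y \<in> powr_ball p" for y
  proof -
    have y: "powr_sum p y \<le> 1" using that by (simp add: powr_ball_def)
    have "x \<bullet> y = (\<Sum>b\<in>Basis. (x \<bullet> b) * (y \<bullet> b))" by (rule euclidean_inner)
    also have "\<dots> \<le> (\<Sum>b\<in>Basis. \<bar>y \<bullet> b\<bar> powr p / p + \<bar>x \<bullet> b\<bar> powr q / q)"
    proof (intro sum_mono)
      fix b
      have "(x \<bullet> b) * (y \<bullet> b) \<le> \<bar>y \<bullet> b\<bar> * \<bar>x \<bullet> b\<bar>"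
        by (metis abs_ge_self abs_mult mult.commute)
      also have "\<dots> \<le> \<bar>y \<bullet> b\<bar> powr p / p + \<bar>x \<bullet> b\<bar> powr q / q"
        by (intro Youngs_inequality pq) auto
      finally show "(x \<bullet> b) * (y \<bullet> b) \<le> \<bar>y \<bullet> b\<bar> powr p / p + \<bar>x \<bullet> b\<bar> powr q / q" .
    qed
    also have "\<dots> = powr_sum p y / p + powr_sum q x / q"
      by (simp add: sum.distrib powr_sum_def sum_divide_distrib)
    also have "\<dots> \<le> 1 / p + 1 / q"
      using x y pq by (intro add_mono divide_right_mono) auto
    finally show ?thesis using pq by simp
  qed
  then show "x \<in> polar_body (powr_ball p)" by (simp add: polar_body_def)
next
  fix x :: 'a
  assume "x \<in> polar_body (powr_ball p)"
  then have polar: "x \<bullet> y \<le> 1" if "powr_sum p y \<le> 1" for y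
    using that by (simp add: polar_body_def powr_ball_def)
  have pq': "(q - 1) * p = q" using pq by (auto simp: field_simps)
  show "x \<in> powr_ball q"
  proof (rule ccontr)
    assume "x \<notin> powr_ball q"
    then have S: "1 < powr_sum q x" by (simp add: powr_ball_def)
    define S where "S = powr_sum q x"
    have S1: "1 < S" using S by (simp add: S_def)
    \<comment> \<open>Since (q - 1)p = q, the unscaled vector has p-th power sum S, so the factor
      S^(-1/p) places y on the boundary of \<open>powr_ball p\<close>. Its product with x is then
      S^(1 - 1/p) = S^(1/q) > 1.\<close>
    define y where "y = S powr (- 1 / p) *\<^sub>R (\<Sum>b\<in>Basis. (sgn (x \<bullet> b) * \<bar>x \<bullet> b\<bar> powr (q - 1)) *\<^sub>R b)"
    have yb: "y \<bullet> b = S powr (- 1 / p) * (sgn (x \<bullet> b) * \<bar>x \<bullet> b\<bar> powr (q - 1))" if "b \<in> Basis" for b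
      using that by (simp add: y_def)
    have "\<bar>y \<bullet> b\<bar> powr p = \<bar>x \<bullet> b\<bar> powr q / S" if "b \<in> Basis" for b
    proof -
      have "\<bar>y \<bullet> b\<bar> = S powr (- 1 / p) * \<bar>x \<bullet> b\<bar> powr (q - 1)"
        unfolding yb[OF that] by (auto simp: abs_mult sgn_if)
      moreover have "(S powr (- 1 / p)) powr p = 1 / S"
        unfolding powr_powr using S1 pq by (simp add: powr_neg_one)
      ultimately show ?thesis
        by (simp add: powr_mult powr_powr pq')
    qed
    then have "powr_sum p y = powr_sum q x / S"
      by (simp add: powr_sum_def sum_divide_distrib)
    then have "x \<bullet> y \<le> 1" using S1 by (intro polar) (simp add: S_def)
    moreover have "x \<bullet> y = S powr (1 / q)"
    proof -
      have "x \<bullet> y = (\<Sum>b\<in>Basis. (x \<bullet> b) * (y \<bullet> b))" by (rule euclidean_inner)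
      also have "\<dots> = (\<Sum>b\<in>Basis. S powr (- 1 / p) * \<bar>x \<bullet> b\<bar> powr q)"
      proof (intro sum.cong refl)
        fix b :: 'a
        assume b: "b \<in> Basis"
        have "\<bar>x \<bullet> b\<bar> powr q = \<bar>x \<bullet> b\<bar> * \<bar>x \<bullet> b\<bar> powr (q - 1)"
          using powr_mult_base[of "\<bar>x \<bullet> b\<bar>" "q - 1"] by simp
        then show "(x \<bullet> b) * (y \<bullet> b) = S powr (- 1 / p) * \<bar>x \<bullet> b\<bar> powr q"
          unfolding yb[OF b] by (simp add: sgn_if)
      qed
      also have "\<dots> = S powr (- 1 / p) * S powr 1"
        using S1 by (simp add: S_def powr_sum_def sum_distrib_left)
      also have "\<dots> = S powr (- 1 / p + 1)" by (simp only: powr_add)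
      also have "- 1 / p + 1 = 1 / q" using pq by simp
      finally show ?thesis .
    qed
    moreover have "1 < S powr (1 / q)" using S1 pq by (intro gr_one_powr) auto
    ultimately show False by simp
  qed
qed

lemma powr_sum_1: "powr_sum 1 x = (\<Sum>b\<in>Basis. \<bar>x \<bullet> b\<bar>)"
  by (simp add: powr_sum_def)

text \<open>Testing against the vertices b and -b bounds each coordinate; the converse is a
  coordinatewise estimate of the inner product.\<close>

lemma polar_powr_ball_1: "polar_body (powr_ball 1 :: 'a::euclidean_space set) = cbox (- One) One"
proof (intro set_eqI iffI)
  fix x :: 'a
  assume x: "x \<in> polar_body (powr_ball 1)"
  have "\<bar>x \<bullet> b\<bar> \<le> 1" if b: "b \<in> Basis" for b
  proof -
    have "powr_sum 1 b = 1" "powr_sum 1 (- b) = 1"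
      using b by (simp_all add: powr_sum_1 inner_Basis if_distrib[of abs] cong: if_cong)
    then have "x \<bullet> b \<le> 1" "x \<bullet> (- b) \<le> 1"
      using x by (auto simp: polar_body_def powr_ball_def simp del: inner_minus_right)
    then show ?thesis by (simp add: abs_le_iff)
  qed
  then show "x \<in> cbox (- One) One" by (simp add: mem_cube_iff)
next
  fix x :: 'a
  assume "x \<in> cbox (- One) One"
  then have x: "\<bar>x \<bullet> b\<bar> \<le> 1" if "b \<in> Basis" for b
    using that by (simp add: mem_cube_iff)
  have "x \<bullet> y \<le> 1" if "powr_sum 1 y \<le> 1" for y
  proof -
    have "x \<bullet> y = (\<Sum>b\<in>Basis. (x \<bullet> b) * (y \<bullet> b))" by (rule euclidean_inner)
    also have "\<dots> \<le> (\<Sum>b\<in>Basis. 1 * \<bar>y \<bullet> b\<bar>)"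
    proof (intro sum_mono)
      fix b :: 'a
      assume "b \<in> Basis"
      then have "\<bar>x \<bullet> b\<bar> * \<bar>y \<bullet> b\<bar> \<le> 1 * \<bar>y \<bullet> b\<bar>" by (intro mult_right_mono x) auto
      then show "(x \<bullet> b) * (y \<bullet> b) \<le> 1 * \<bar>y \<bullet> b\<bar>"
        by (metis abs_ge_self abs_mult order_trans)
    qed
    finally show ?thesis using that by (simp add: powr_sum_1)
  qed
  then show "x \<in> polar_body (powr_ball 1)" by (simp add: polar_body_def powr_ball_def)
qed

text \<open>Testing x against its own sign vector yields the sum of the absolute coordinates. The
  converse is the inclusion of a set in its bipolar, combined with
  \<open>polar_powr_ball_1\<close>.\<close>

lemma polar_cube: "polar_body (cbox (- One) One :: 'a::euclidean_space set) = powr_ball 1"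
proof (intro set_eqI iffI)
  fix x :: 'a
  assume x: "x \<in> polar_body (cbox (- One) One)"
  define y where "y = (\<Sum>b\<in>Basis. sgn (x \<bullet> b) *\<^sub>R b)"
  have yb: "y \<bullet> b = sgn (x \<bullet> b)" if "b \<in> Basis" for b
    using that by (simp add: y_def)
  have "y \<in> cbox (- One) One"
    by (auto simp: mem_cube_iff yb sgn_if)
  then have "x \<bullet> y \<le> 1" using x by (auto simp: polar_body_def)
  moreover have "x \<bullet> y = (\<Sum>b\<in>Basis. (x \<bullet> b) * (y \<bullet> b))" by (rule euclidean_inner)
  moreover have "\<dots> = powr_sum 1 x"
    unfolding powr_sum_1 by (intro sum.cong refl) (auto simp: yb sgn_if)
  ultimately show "x \<in> powr_ball 1" by (simp add: powr_ball_def)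
next
  fix x :: 'a
  assume "x \<in> powr_ball 1"
  moreover have "powr_ball 1 \<subseteq> polar_body (polar_body (powr_ball 1 :: 'a set))"
    by (auto simp: polar_body_def inner_commute)
  ultimately show "x \<in> polar_body (cbox (- One) One)" by (auto simp: polar_powr_ball_1)
qed

section \<open>Values of \<open>phi\<close> on the balls\<close>

lemma phi_powr_ball:
  assumes pq: "1 < p" "1 < q" "1 / p + 1 / q = 1"
  shows "phi (powr_ball p :: 'a::euclidean_space set) = DIM('a) * ball_ratio DIM('a) p * ball_ratio DIM('a) q"
  using pq by (intro phi_unconditional)
    (auto simp: polar_powr_ball[OF pq] unconditional_powr_ball compact_powr_ball
       measure_powr_ball_pos set_integral_sq_powr_ball)

lemma phi_powr_ball_1:
  "phi (powr_ball 1 :: 'a::euclidean_space set) = DIM('a) * ball_ratio DIM('a) 1 * (1 / 3)"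
  by (intro phi_unconditional)
    (auto simp: polar_powr_ball_1 unconditional_powr_ball compact_powr_ball unconditional_cube
       measure_powr_ball_pos set_integral_sq_powr_ball measure_cube set_integral_sq_cube simp del: One_nat_def)

lemma phi_cube:
  "phi (cbox (- One) One :: 'a::euclidean_space set) = DIM('a) * ball_ratio DIM('a) 1 * (1 / 3)"
proof -
  have "phi (cbox (- One) One :: 'a set) = DIM('a) * (1 / 3) * ball_ratio DIM('a) 1"
    by (intro phi_unconditional)
      (auto simp: polar_cube unconditional_powr_ball compact_powr_ball unconditional_cube
         measure_powr_ball_pos set_integral_sq_powr_ball measure_cube set_integral_sq_cube)
  then show ?thesis by simp
qed

section \<open>Evaluating and comparing \<open>ball_ratio\<close>\<close>

lemma Gamma_plus1_pos: "0 < x \<Longrightarrow> Gamma (x + 1) = x * Gamma x" for x :: real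
  by (rule Gamma_plus1) (auto elim!: nonpos_Ints_cases)

lemma ball_ratio_1:
  assumes "1 \<le> n"
  shows "ball_ratio n 1 = 2 / ((real n + 1) * (real n + 2))"
proof -
  have "Gamma (real n + 2 + 1) = (real n + 2) * ((real n + 1) * Gamma (real n + 1))"
    using Gamma_plus1_pos[of "real n + 2"] Gamma_plus1_pos[of "real n + 1"] by (simp add: add.commute)
  moreover have "Gamma (4::real) = 6" "Gamma (2::real) = 1"
    using Gamma_numeral[of "num.Bit0 (num.Bit0 num.One)"] Gamma_numeral[of "num.Bit0 num.One"]
    by (simp_all add: fact_numeral)
  moreover have "0 < Gamma (real n + 1)" by (intro Gamma_real_pos) auto
  moreover have "ball_ratio n 1 = Gamma 4 * Gamma (real n + 1) / (3 * Gamma 2 * Gamma (real n + 2 + 1))"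
    by (simp add: ball_ratio_def)
  moreover have "6 * g / (3 * 1 * ((real n + 2) * ((real n + 1) * g))) = 2 / ((real n + 1) * (real n + 2))" if "0 < g" for g :: real
  proof -
    have "0 < real n + 1" "0 < real n + 2" by auto
    with that show ?thesis by (simp add: divide_simps)
  qed
  ultimately show ?thesis by (simp only:)
qed

text \<open>At p = 2 the arguments 3/p and 1/p differ by 1, as do (n+2)/p and n/p, so one step of
  the functional equation in each pair cancels all Gamma values.\<close>

lemma ball_ratio_2:
  assumes "1 \<le> n"
  shows "ball_ratio n 2 = 1 / (real n + 2)"
proof -
  have "Gamma (3 / 2 + 1 :: real) = 3 / 2 * Gamma (1 / 2 + 1)"
    using Gamma_plus1_pos[of "3 / 2 :: real"] by simp
  moreover have "Gamma ((real n + 2) / 2 + 1) = (real n + 2) / 2 * Gamma (n / 2 + 1)"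
  proof -
    have "(real n + 2) / 2 = n / 2 + 1" by (simp add: field_simps)
    then show ?thesis
      by (simp only:) (rule Gamma_plus1_pos, simp add: add_nonneg_pos)
  qed
  moreover have "0 < Gamma (real n / 2 + 1)" "0 < Gamma (1 / 2 + 1 :: real)"
    by (auto intro!: add_nonneg_pos)
  moreover have "(3 / 2 * g) * h / (3 * g * ((real n + 2) / 2 * h)) = 1 / (real n + 2)"
    if "0 < g" "0 < h" for g h :: real
    using that by (simp add: divide_simps)
  ultimately show ?thesis by (simp only: ball_ratio_def)
qed

text \<open>The functional equation removes the +1 in all four Gamma arguments. The extracted
  factors (3s)(ns) / (3 s (n+2)s) leave n/(n+2), independent of s.\<close>

lemma ball_ratio_eq_ln_Gamma_comb:
  assumes n: "1 \<le> n" and s: "0 < s"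
  shows "ball_ratio n (1 / s) = n / (real n + 2) * exp (- ln_Gamma_comb n s)"
proof -
  have G: "Gamma (x * s + 1) = x * s * exp (ln_Gamma (x * s))" if "0 < x" for x
    using that s Gamma_plus1_pos[of "x * s"] by (simp add: Gamma_real_pos_exp)
  have G1: "Gamma (s + 1) = s * exp (ln_Gamma s)" using G[of 1] by simp
  have "exp (- ln_Gamma_comb n s)
      = exp (ln_Gamma (n * s)) * exp (ln_Gamma (3 * s)) / (exp (ln_Gamma s) * exp (ln_Gamma ((real n + 2) * s)))"
    unfolding ln_Gamma_comb_def by (simp add: add.commute flip: exp_add exp_diff)
  moreover have "ball_ratio n (1 / s) = Gamma (3 * s + 1) * Gamma (n * s + 1) / (3 * Gamma (s + 1) * Gamma ((real n + 2) * s + 1))"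
    unfolding ball_ratio_def by simp
  moreover have "0 < real n" "0 < real n + 2" using n by auto
  moreover have "(3 * s * A) * (n * s * B) / (3 * (s * C) * ((real n + 2) * s * D))
      = n / (real n + 2) * (B * A / (C * D))" for A B C D :: real
    using s by (simp add: divide_simps)
  ultimately show ?thesis
    by (simp only: G G1 zero_less_numeral)
qed

text \<open>Midpoint convexity of \<open>ln_Gamma_comb\<close> at 1/p and 1/q, whose midpoint is
  1/2, after exponentiating with reversed sign.\<close>

lemma ball_ratio_mult_le:
  assumes n: "1 \<le> n" and pq: "1 < p" "1 < q" "1 / p + 1 / q = 1"
  shows "ball_ratio n p * ball_ratio n q \<le> (ball_ratio n 2)\<^sup>2"
proof -
  have p: "0 < 1 / p" and q: "0 < 1 / q" using pq by auto
  have "2 * ln_Gamma_comb n (1 / 2) \<le> ln_Gamma_comb n (1 / p) + ln_Gamma_comb n (1 / q)"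
    using ln_Gamma_comb_midpoint[of n "1 / p" "1 / q"] n pq by simp
  then have le: "exp (- ln_Gamma_comb n (1 / p)) * exp (- ln_Gamma_comb n (1 / q)) \<le> (exp (- ln_Gamma_comb n (1 / 2)))\<^sup>2"
    by (simp add: power2_eq_square flip: exp_add)
  let ?k = "real n / (real n + 2)"
  have "ball_ratio n p = ?k * exp (- ln_Gamma_comb n (1 / p))"
    using ball_ratio_eq_ln_Gamma_comb[OF n p] by simp
  moreover have "ball_ratio n q = ?k * exp (- ln_Gamma_comb n (1 / q))"
    using ball_ratio_eq_ln_Gamma_comb[OF n q] by simp
  moreover have "ball_ratio n 2 = ?k * exp (- ln_Gamma_comb n (1 / 2))"
    using ball_ratio_eq_ln_Gamma_comb[OF n, of "1 / 2"] by simp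
  moreover have "?k\<^sup>2 * (exp (- ln_Gamma_comb n (1 / p)) * exp (- ln_Gamma_comb n (1 / q)))
      \<le> ?k\<^sup>2 * (exp (- ln_Gamma_comb n (1 / 2)))\<^sup>2"
    by (intro mult_left_mono le) auto
  ultimately show ?thesis
    by (simp only: power_mult_distrib) (simp only: power2_eq_square ac_simps)
qed

section \<open>Transfer to \<open>lp_ball\<close> and the maximum over p\<close>

lemma Basis_real_vec: "(Basis :: (real ^ 'n) set) = range (\<lambda>i. axis i 1)"
  by (auto simp: Basis_vec_def)

lemma sum_Basis_vec: "(\<Sum>b\<in>Basis. f ((x::real ^ 'n) \<bullet> b)) = (\<Sum>i\<in>UNIV. f (x $ i))"
proof -
  have "(\<Sum>b\<in>range (\<lambda>i. axis i 1). f (x \<bullet> b)) = (\<Sum>i\<in>UNIV. f (x $ i))"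
    by (subst sum.reindex) (auto simp: inj_on_def axis_eq_axis inner_axis)
  then show ?thesis by (simp add: Basis_real_vec)
qed

lemma lp_ball_eq_powr_ball: "lp_ball (ereal p) = powr_ball p"
  by (simp add: lp_ball_def powr_ball_def powr_sum_def sum_Basis_vec[where f="\<lambda>t. \<bar>t\<bar> powr p"])

lemma lp_ball_infinity: "lp_ball \<infinity> = (cbox (- One) One :: (real ^ 'n) set)"
proof (rule set_eqI)
  fix x :: "real ^ 'n"
  show "x \<in> lp_ball \<infinity> \<longleftrightarrow> x \<in> cbox (- One) One"
    unfolding mem_cube_iff by (auto simp: lp_ball_def Basis_real_vec inner_axis)
qed

theorem theorem1p1:
  shows "(\<forall>p::ereal. 1 \<le> p \<longrightarrow> phi (lp_ball p :: (real ^ 'n) set) \<le> phi (lp_ball 2 :: (real ^ 'n) set))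
    \<and> phi (lp_ball 2 :: (real ^ 'n) set) = real CARD('n) / (real CARD('n) + 2)\<^sup>2"
proof (intro conjI allI impI)
  let ?n = "CARD('n)"
  have n: "1 \<le> ?n" by (simp add: Suc_leI)
  have two: "lp_ball 2 = (powr_ball 2 :: (real ^ 'n) set)"
    using lp_ball_eq_powr_ball[of 2] by simp
  have phi2: "phi (lp_ball 2 :: (real ^ 'n) set) = ?n * (ball_ratio ?n 2)\<^sup>2"
    unfolding two by (subst phi_powr_ball[of 2 2]) (auto simp: power2_eq_square)
  then show val: "phi (lp_ball 2 :: (real ^ 'n) set) = real ?n / (real ?n + 2)\<^sup>2"
    using ball_ratio_2[OF n] by (simp add: power_divide)
  \<comment> \<open>The left side is the common value of \<open>phi\<close> at p = 1 and p =
    \<infinity>. Clearing denominators reduces the claim to 2(n + 2) \<le> 3(n + 1), that is, n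
    \<ge> 1.\<close>
  have end_le: "?n * ball_ratio ?n 1 * (1 / 3) \<le> real ?n / (real ?n + 2)\<^sup>2"
  proof -
    have "2 / (3 * ((real ?n + 1) * (real ?n + 2))) \<le> 1 / (real ?n + 2)\<^sup>2"
    proof -
      have "2 * (real ?n + 2) \<le> 3 * (real ?n + 1)" using n by simp
      then have "2 * (real ?n + 2) * (real ?n + 2) \<le> 3 * (real ?n + 1) * (real ?n + 2)"
        by (intro mult_right_mono) auto
      then show ?thesis
        by (simp add: divide_simps power2_eq_square mult.assoc add_pos_pos)
    qed
    then have "?n * (2 / (3 * ((real ?n + 1) * (real ?n + 2)))) \<le> ?n * (1 / (real ?n + 2)\<^sup>2)"
      by (intro mult_left_mono) auto
    then show ?thesis by (simp add: ball_ratio_1[OF n] ac_simps)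
  qed
  fix p :: ereal
  assume p: "1 \<le> p"
  show "phi (lp_ball p :: (real ^ 'n) set) \<le> phi (lp_ball 2 :: (real ^ 'n) set)"
  proof (cases p)
    case (real r)
    show ?thesis
    proof (cases "r = 1")
      case True
      then show ?thesis
        using end_le unfolding val phi_powr_ball_1[where 'a="real ^ 'n", symmetric]
        by (simp add: real lp_ball_eq_powr_ball phi_powr_ball_1)
    next
      case False
      then have r: "1 < r" using p real by simp
      \<comment> \<open>The exponent conjugate to r.\<close>
      define q where "q = r / (r - 1)"
      have q: "1 < q" "1 / r + 1 / q = 1" using r by (auto simp: q_def field_simps)
      have "?n * (ball_ratio ?n r * ball_ratio ?n q) \<le> ?n * (ball_ratio ?n 2)\<^sup>2"
        by (intro mult_left_mono ball_ratio_mult_le n r q) auto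
      then show ?thesis
        using phi_powr_ball[OF r q, where 'a="real ^ 'n"] phi2 real
        by (simp add: lp_ball_eq_powr_ball mult.assoc)
    qed
  next
    case PInf
    then show ?thesis
      using end_le unfolding val by (simp add: lp_ball_infinity phi_cube)
  next
    case MInf
    with p show ?thesis by simp
  qed
qed

end
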